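(* Let $\Gamma\le S_m$ and let $a_1,\dots,a_m\ge 2$ be integers. Let $O_1,\dots,O_t$ be the orbits of the action of the commutator subgroup $[\Gamma,\Gamma]$ on $[m]$, and for each $i$ let $n_i=\min\{a_j: j\in O_i\}$. Then \[R_\Gamma(a_1,a_2,\dots,a_m)\le R(n_1,n_2,\dots,n_t).\]
   Context: An $m$-edge-coloured complete graph is a complete graph with each edge coloured from $[m]=\{1,\dots,m\}$. For $\Gamma\le S_m$, $\pi\in\Gamma$ and a vertex $v$, switching at $v$ with $\pi$ recolours every edge incident with $v$ of colour $i$ to colour $\pi(i)$, leaving other edges unchanged. Two such graphs on the same vertex set are $\Gamma$-switch equivalent if one is obtained from the other by a finite sequence of switches. $K_t^{(i)}$ is a complete graph on $t$ vertices with all edges of colour $i$. $R_\Gamma(a_1,\dots,a_m)$ is the least $n$ such that every $m$-edge-coloured complete graph on $n$ vertices is $\Gamma$-switch equivalent to one containing, for some $i$, a copy of $K_{a_i}^{(i)}$. $R(\cdot)$ is the classical multicolour Ramsey number. $[\Gamma,\Gamma]$ is the commutator subgroup of $\Gamma$. *)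

theory Defs
  imports "HOL-Library.Ramsey" "HOL-Algebra.Sym_Groups" "HOL-Algebra.Group_Action"
begin

text \<open>The edges of the complete graph on V are the two-element subsets of V. Colourings are
  extensional, so that two colourings are equal iff they agree on all edges.\<close>

definition edge_colourings :: "nat \<Rightarrow> 'a set \<Rightarrow> ('a set \<Rightarrow> nat) set" where
  "edge_colourings m V = nsets V 2 \<rightarrow>\<^sub>E {1..m}"

definition switch :: "'a set \<Rightarrow> 'a \<Rightarrow> (nat \<Rightarrow> nat) \<Rightarrow> ('a set \<Rightarrow> nat) \<Rightarrow> ('a set \<Rightarrow> nat)" where
  "switch V v p c = (\<lambda>e. if e \<in> nsets V 2 \<and> v \<in> e then p (c e) else c e)"

text \<open>This relation is symmetric when \<open>\<Gamma>\<close> is a group of permutations, since a switch with p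
  is undone by a switch at the same vertex with the inverse of p.\<close>

definition switch_equivalent ::
  "'a set \<Rightarrow> (nat \<Rightarrow> nat) set \<Rightarrow> ('a set \<Rightarrow> nat) \<Rightarrow> ('a set \<Rightarrow> nat) \<Rightarrow> bool" where
  "switch_equivalent V \<Gamma> = (\<lambda>c d. \<exists>v\<in>V. \<exists>p\<in>\<Gamma>. d = switch V v p c)\<^sup>*\<^sup>*"

definition switch_arrows :: "nat \<Rightarrow> (nat \<Rightarrow> nat) set \<Rightarrow> (nat \<Rightarrow> nat) \<Rightarrow> nat \<Rightarrow> bool" where
  "switch_arrows m \<Gamma> a n \<longleftrightarrow>
     (\<forall>c \<in> edge_colourings m {..<n}. \<exists>d. switch_equivalent {..<n} \<Gamma> c d \<and>
        (\<exists>i\<in>{1..m}. monochromatic {..<n} (a i) 2 d i))"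

text \<open>The sizes \<open>a 1, \<dots>, a m\<close> are the values of a function on \<open>{1..m}\<close>.\<close>

definition switch_ramsey :: "nat \<Rightarrow> (nat \<Rightarrow> nat) set \<Rightarrow> (nat \<Rightarrow> nat) \<Rightarrow> nat" where
  "switch_ramsey m \<Gamma> a = (LEAST n. switch_arrows m \<Gamma> a n)"

text \<open>The colours here are the positions \<open>0, \<dots>, length ns - 1\<close>.\<close>

definition ramsey_number :: "nat list \<Rightarrow> nat" where
  "ramsey_number ns = (LEAST n. partn_lst {..<n} ns 2)"

text \<open>Both minima are attained.\<close>

lemma partn_lst_ramsey_number: "partn_lst {..<ramsey_number ns} ns 2"
  unfolding ramsey_number_def using ramsey_full by (rule LeastI_ex)

lemma switch_arrows_switch_ramsey: "switch_arrows m \<Gamma> a (switch_ramsey m \<Gamma> a)"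
proof -
  let ?as = "map a [1..<Suc m]"
  obtain N :: nat where N: "partn_lst {..<N} ?as 2"
    using ramsey_full by blast
  have "switch_arrows m \<Gamma> a N"
    unfolding switch_arrows_def
  proof
    fix c assume c: "c \<in> edge_colourings m {..<N}"
    have cm: "c e \<in> {1..m}" if "e \<in> nsets {..<N} 2" for e
      using c that by (auto simp: edge_colourings_def)
    have "(\<lambda>e. c e - 1) \<in> nsets {..<N} 2 \<rightarrow> {..<length ?as}"
      using cm by fastforce
    then obtain i where i: "i < length ?as" "monochromatic {..<N} (?as ! i) 2 (\<lambda>e. c e - 1) i"
      using N unfolding partn_lst_def by blast
    then obtain H where H: "H \<in> nsets {..<N} (?as ! i)" "(\<lambda>e. c e - 1) ` nsets H 2 \<subseteq> {i}"
      unfolding monochromatic_def by blast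
    have im: "i < m" using i(1) by (simp del: upt_Suc)
    then have ai: "?as ! i = a (Suc i)" by (simp del: upt_Suc)
    have "c e = Suc i" if "e \<in> nsets H 2" for e
    proof -
      have "e \<in> nsets {..<N} 2" using that H(1) by (auto simp: nsets_def)
      moreover have "c e - 1 = i" using that H(2) by blast
      ultimately show ?thesis using cm by fastforce
    qed
    then have "monochromatic {..<N} (a (Suc i)) 2 c (Suc i)"
      using H(1) ai unfolding monochromatic_def by auto
    moreover have "switch_equivalent {..<N} \<Gamma> c c"
      by (simp add: switch_equivalent_def)
    ultimately show "\<exists>d. switch_equivalent {..<N} \<Gamma> c d \<and>
        (\<exists>i\<in>{1..m}. monochromatic {..<N} (a i) 2 d i)"
      using im by (intro exI[of _ c]) auto
  qed
  then show ?thesis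
    unfolding switch_ramsey_def by (rule LeastI)
qed

text \<open>The orbits on \<open>{1..m}\<close> of the commutator subgroup, which acts by application.\<close>

definition commutator_orbits :: "nat \<Rightarrow> (nat \<Rightarrow> nat) set \<Rightarrow> nat set set" where
  "commutator_orbits m \<Gamma> =
     orbits ((sym_group m)\<lparr>carrier := derived (sym_group m) \<Gamma>\<rparr>) {1..m} (\<lambda>g. g)"

end

theory Submission
  imports Defs
begin

text \<open>Switching at u and v alternately with \<open>h\<inverse>\<close>, \<open>g\<inverse>\<close>, \<open>h\<close>, \<open>g\<close> applies the commutator of g and h
  to the colour of the edge uv and restores every other edge. Hence each edge can be recoloured
  inside its orbit under the commutator subgroup independently of all the others, so a
  clique all of whose edge colours lie in one orbit can be given any single colour of
  that orbit; we choose the one that minimises the required clique size.\<close>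

lemma switch_equivalent_switch:
  "v \<in> V \<Longrightarrow> p \<in> \<Gamma> \<Longrightarrow> switch_equivalent V \<Gamma> c (switch V v p c)"
  unfolding switch_equivalent_def by blast

lemma switch_equivalent_trans:
  "switch_equivalent V \<Gamma> c d \<Longrightarrow> switch_equivalent V \<Gamma> d e \<Longrightarrow> switch_equivalent V \<Gamma> c e"
  unfolding switch_equivalent_def by (rule rtranclp_trans)

text \<open>The innermost switch acts first. An edge meeting only \<open>u\<close> sees
  \<open>inv' g\<close> and then \<open>g\<close>, an edge meeting only \<open>v\<close> sees
  \<open>inv' h\<close> and then \<open>h\<close>, so both get their colours back. Only an edge
  containing both vertices sees all four permutations, and \<open>{u, v}\<close> is the only such
  edge.\<close>

lemma switch_commutator:
  assumes "bij g" "bij h" and uv: "u \<in> V" "v \<in> V" "u \<noteq> v"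
  shows "switch V u g (switch V v h (switch V u (inv' g) (switch V v (inv' h) c)))
    = c({u, v} := g (h (inv' g (inv' h (c {u, v})))))"
proof
  fix e
  have gh: "g (inv' g x) = x" "h (inv' h x) = x" for x
    using assms(1,2) by (simp_all add: bij_is_surj surj_f_inv_f)
  have "{u, v} \<in> nsets V 2"
    using uv by (simp add: nsets_2_eq) blast
  moreover have "e = {u, v}" if "e \<in> nsets V 2" "u \<in> e" "v \<in> e"
    using that uv by (auto simp: nsets_2_eq)
  ultimately show "switch V u g (switch V v h (switch V u (inv' g) (switch V v (inv' h) c))) e
    = (c({u, v} := g (h (inv' g (inv' h (c {u, v})))))) e"
    using gh by (cases "e \<in> nsets V 2"; cases "u \<in> e"; cases "v \<in> e") (auto simp: switch_def)
qed

lemma switch_equivalent_commutator: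
  assumes \<Gamma>: "subgroup \<Gamma> (sym_group m)" and gh: "g \<in> \<Gamma>" "h \<in> \<Gamma>" and e: "e \<in> nsets V 2"
  shows "switch_equivalent V \<Gamma> c (c(e := (g \<circ> h \<circ> inv' g \<circ> inv' h) (c e)))"
proof -
  obtain u v where uv: "e = {u, v}" "u \<in> V" "v \<in> V" "u \<noteq> v"
    using e by (auto simp: nsets_2_eq)
  have carrier: "g \<in> carrier (sym_group m)" "h \<in> carrier (sym_group m)"
    using subgroup.mem_carrier[OF \<Gamma>] gh by auto
  then have "bij g" "bij h"
    by (auto simp: sym_group_carrier permutes_bij)
  \<comment> \<open>Each of the four switches must use an element of \<Gamma>, so closure under
    inverses enters here.\<close>
  have "inv' g \<in> \<Gamma>" "inv' h \<in> \<Gamma>"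
    using subgroup.m_inv_closed[OF \<Gamma>] gh carrier by (metis sym_group_inv_equality)+
  then have "switch_equivalent V \<Gamma> c
      (switch V u g (switch V v h (switch V u (inv' g) (switch V v (inv' h) c))))"
    using uv gh by (blast intro: switch_equivalent_switch switch_equivalent_trans)
  then show ?thesis
    using uv \<open>bij g\<close> \<open>bij h\<close> by (simp add: switch_commutator)
qed

text \<open>Induction on how \<open>p\<close> is generated from commutators. The colouring stays
  arbitrary because a product is realised by two recolourings in succession, the second starting
  from the result of the first.\<close>

lemma switch_equivalent_derived:
  assumes \<Gamma>: "subgroup \<Gamma> (sym_group m)" and p: "p \<in> derived (sym_group m) \<Gamma>"
    and e: "e \<in> nsets V 2"
  shows "switch_equivalent V \<Gamma> c (c(e := p (c e)))"
proof -
  interpret group "sym_group m" by (rule sym_group_is_group)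
  have carrier: "x \<in> carrier (sym_group m)" if "x \<in> \<Gamma>" for x
    using subgroup.mem_carrier[OF \<Gamma> that] .
  have comm: "switch_equivalent V \<Gamma> c (c(e := x (c e)))"
    if x: "x \<in> derived_set (sym_group m) \<Gamma>" for x c
  proof -
    obtain g h where gh: "g \<in> \<Gamma>" "h \<in> \<Gamma>"
      and "x = g \<otimes>\<^bsub>sym_group m\<^esub> h \<otimes>\<^bsub>sym_group m\<^esub> inv\<^bsub>sym_group m\<^esub> g \<otimes>\<^bsub>sym_group m\<^esub> inv\<^bsub>sym_group m\<^esub> h"
      using x by blast
    then have "x = g \<circ> h \<circ> inv' g \<circ> inv' h"
      using carrier by (simp add: sym_group_mult sym_group_inv_equality)
    then show ?thesis
      using switch_equivalent_commutator[OF \<Gamma> gh e] by simp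
  qed
  show ?thesis
    using p unfolding derived_def
  proof (induction arbitrary: c)
    case one
    then show ?case by (simp add: sym_group_one switch_equivalent_def)
  next
    case (incl x)
    then show ?case by (rule comm)
  next
    case (inv x)
    then obtain g h where gh: "g \<in> \<Gamma>" "h \<in> \<Gamma>"
      and x: "x = g \<otimes>\<^bsub>sym_group m\<^esub> h \<otimes>\<^bsub>sym_group m\<^esub> inv\<^bsub>sym_group m\<^esub> g \<otimes>\<^bsub>sym_group m\<^esub> inv\<^bsub>sym_group m\<^esub> h"
      by blast
    \<comment> \<open>The inverse of the commutator of \<open>g\<close> and \<open>h\<close> is the
      commutator of \<open>h\<close> and \<open>g\<close>, so it is again a generator.\<close>
    have "inv\<^bsub>sym_group m\<^esub> x
      = h \<otimes>\<^bsub>sym_group m\<^esub> g \<otimes>\<^bsub>sym_group m\<^esub> inv\<^bsub>sym_group m\<^esub> h \<otimes>\<^bsub>sym_group m\<^esub> inv\<^bsub>sym_group m\<^esub> g"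
      using gh carrier by (simp add: x inv_mult_group m_assoc del: sym_group_inv_equality)
    then have "inv\<^bsub>sym_group m\<^esub> x \<in> derived_set (sym_group m) \<Gamma>"
      using gh by blast
    then show ?case by (rule comm)
  next
    case (eng p q)
    \<comment> \<open>In the product the factor \<open>q\<close> acts first, so the hypothesis for
      \<open>p\<close> is instantiated with the colouring already changed by
      \<open>q\<close>.\<close>
    have "switch_equivalent V \<Gamma> (c(e := q (c e)))
        ((c(e := q (c e)))(e := p ((c(e := q (c e))) e)))"
      by (rule eng.IH(1))
    then have "switch_equivalent V \<Gamma> (c(e := q (c e))) (c(e := p (q (c e))))"
      by simp
    then have "switch_equivalent V \<Gamma> c (c(e := p (q (c e))))"
      by (rule switch_equivalent_trans[OF eng.IH(2)])
    then show ?case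
      by (simp only: sym_group_mult o_apply)
  qed
qed

text \<open>The edges of \<open>F\<close> are treated one at a time. No recolouring disturbs another
  edge, so it suffices that the target is reachable from each original colour.\<close>

lemma switch_equivalent_recolour:
  assumes \<Gamma>: "subgroup \<Gamma> (sym_group m)" and "finite F" "F \<subseteq> nsets V 2"
    and "\<And>e. e \<in> F \<Longrightarrow> \<exists>p\<in>derived (sym_group m) \<Gamma>. p (c e) = j"
  shows "switch_equivalent V \<Gamma> c (\<lambda>e. if e \<in> F then j else c e)"
  using assms(2-)
proof (induction F rule: finite_induct)
  case empty
  then show ?case by (simp add: switch_equivalent_def)
next
  case (insert e F)
  let ?d = "\<lambda>e. if e \<in> F then j else c e"
  obtain p where p: "p \<in> derived (sym_group m) \<Gamma>" "p (c e) = j"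
    using insert.prems by blast
  have "switch_equivalent V \<Gamma> c ?d"
    using insert by blast
  moreover have "switch_equivalent V \<Gamma> ?d (?d(e := p (?d e)))"
    using switch_equivalent_derived[OF \<Gamma> p(1)] insert.prems by blast
  \<comment> \<open>As \<open>e\<close> is not in \<open>F\<close>, it still has its original colour
    in \<open>?d\<close>, and the \<open>p\<close> chosen for \<open>c e\<close> applies.\<close>
  moreover have "?d(e := p (?d e)) = (\<lambda>e'. if e' \<in> insert e F then j else c e')"
    using insert.hyps p(2) by auto
  ultimately show ?case
    using switch_equivalent_trans by metis
qed

lemma commutator_orbits_transitive:
  assumes \<Gamma>: "subgroup \<Gamma> (sym_group m)" and "X \<in> commutator_orbits m \<Gamma>" "x \<in> X" "y \<in> X"
  shows "\<exists>p\<in>derived (sym_group m) \<Gamma>. p x = y"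
proof -
  interpret group "sym_group m" by (rule sym_group_is_group)
  have sub: "subgroup (derived (sym_group m) \<Gamma>) (sym_group m)"
    using \<Gamma> by (simp add: derived_is_subgroup subgroup.subset)
  obtain z p q where pq: "p \<in> derived (sym_group m) \<Gamma>" "q \<in> derived (sym_group m) \<Gamma>"
    "x = p z" "y = q z"
    using assms(2-) by (auto simp: commutator_orbits_def orbits_def orbit_def)
  have p: "p \<in> carrier (sym_group m)"
    using subgroup.mem_carrier[OF sub pq(1)] .
  then have "inv' p \<in> derived (sym_group m) \<Gamma>"
    using subgroup.m_inv_closed[OF sub pq(1)] by (simp add: sym_group_inv_equality)
  \<comment> \<open>Go from \<open>x\<close> back to the representative \<open>z\<close> of the
    orbit, then on to \<open>y\<close>.\<close>
  then have "q \<circ> inv' p \<in> derived (sym_group m) \<Gamma>"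
    using subgroup.m_closed[OF sub pq(2)] by (simp add: sym_group_mult)
  moreover have "(q \<circ> inv' p) x = y"
    using p pq(3,4) by (simp add: sym_group_carrier permutes_inverses)
  ultimately show ?thesis by blast
qed

lemma commutator_orbits_cover:
  assumes "subgroup \<Gamma> (sym_group m)" "x \<in> {1..m}"
  shows "\<exists>X\<in>commutator_orbits m \<Gamma>. x \<in> X"
proof -
  have "id \<in> derived (sym_group m) \<Gamma>"
    using generate.one[of "sym_group m"] by (simp add: derived_def sym_group_one)
  then have "x \<in> orbit ((sym_group m)\<lparr>carrier := derived (sym_group m) \<Gamma>\<rparr>) (\<lambda>g. g) x"
    unfolding orbit_def by (intro CollectI exI[of _ id]) simp
  then show ?thesis
    using assms(2) by (auto simp: commutator_orbits_def orbits_def)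
qed

text \<open>This makes every orbit finite, so that the minimum over it is attained, and ensures that
  a colour chosen from an orbit is one of the \<open>m\<close> colours.\<close>

lemma commutator_orbits_subset:
  assumes \<Gamma>: "subgroup \<Gamma> (sym_group m)" and "X \<in> commutator_orbits m \<Gamma>"
  shows "X \<subseteq> {1..m}"
proof -
  interpret group "sym_group m" by (rule sym_group_is_group)
  have "p permutes {1..m}" if "p \<in> derived (sym_group m) \<Gamma>" for p
    using derived_in_carrier[OF subgroup.subset[OF \<Gamma>]] that by (auto simp: sym_group_carrier)
  then show ?thesis
    using assms(2) by (force simp: commutator_orbits_def orbits_def orbit_def permutes_in_image
      simp del: atLeastAtMost_iff)
qed

lemma commutator_orbits_nonempty:
  assumes "X \<in> commutator_orbits m \<Gamma>"
  shows "X \<noteq> {}"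
  using assms generate.one[of "sym_group m"]
  by (auto simp: commutator_orbits_def orbits_def orbit_def derived_def)

lemma switch_arrows_if_partn_lst:
  assumes \<Gamma>: "subgroup \<Gamma> (sym_group m)" and Os: "set Os = commutator_orbits m \<Gamma>"
    and n: "partn_lst {..<n} (map (\<lambda>X. Min (a ` X)) Os) 2"
  shows "switch_arrows m \<Gamma> a n"
  unfolding switch_arrows_def
proof
  fix c assume c: "c \<in> edge_colourings m {..<n}"
  have "\<exists>k<length Os. c e \<in> Os ! k" if "e \<in> nsets {..<n} 2" for e
  proof -
    have "c e \<in> {1..m}"
      using c that by (auto simp: edge_colourings_def)
    then show ?thesis
      using commutator_orbits_cover[OF \<Gamma>] Os by (metis in_set_conv_nth)
  qed
  \<comment> \<open>The auxiliary colouring \<open>f\<close> remembers only the orbit of a colour,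
    as a position in \<open>Os\<close> counted from 0. The classical Ramsey property is applied to
    \<open>f\<close>.\<close>
  then obtain f where f: "\<And>e. e \<in> nsets {..<n} 2 \<Longrightarrow> f e < length Os \<and> c e \<in> Os ! f e"
    by metis
  then have "f \<in> nsets {..<n} 2 \<rightarrow> {..<length (map (\<lambda>X. Min (a ` X)) Os)}"
    by simp
  then obtain k H where k: "k < length Os" and H: "H \<in> nsets {..<n} (Min (a ` (Os ! k)))"
    and fH: "f ` nsets H 2 \<subseteq> {k}"
    using n unfolding partn_lst_def monochromatic_def by fastforce
  have X: "Os ! k \<in> commutator_orbits m \<Gamma>"
    using k Os nth_mem by blast
  then have "finite (Os ! k)" "Os ! k \<noteq> {}"
    using commutator_orbits_subset[OF \<Gamma>] commutator_orbits_nonempty finite_subset by blast+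
  then have "Min (a ` (Os ! k)) \<in> a ` (Os ! k)"
    by simp
  \<comment> \<open>The clique \<open>H\<close> has exactly the size that the minimising colour
    \<open>j\<close> demands, so \<open>j\<close> is the colour to give to all its edges.\<close>
  then obtain j where j: "j \<in> Os ! k" "Min (a ` (Os ! k)) = a j"
    by blast
  let ?F = "nsets H 2"
  let ?d = "\<lambda>e. if e \<in> ?F then j else c e"
  have F: "?F \<subseteq> nsets {..<n} 2"
    using H by (auto simp: nsets_def)
  have "finite H"
    using H by (auto simp: nsets_def)
  then have "finite ?F"
    by (simp add: finite_imp_finite_nsets)
  moreover have "\<exists>p\<in>derived (sym_group m) \<Gamma>. p (c e) = j" if "e \<in> ?F" for e
    using commutator_orbits_transitive[OF \<Gamma> X _ j(1)] f F fH that by blast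
  ultimately have "switch_equivalent {..<n} \<Gamma> c ?d"
    using switch_equivalent_recolour[OF \<Gamma> _ F] by blast
  moreover have "monochromatic {..<n} (a j) 2 ?d j"
    using H j(2) by (auto simp: monochromatic_def)
  moreover have "j \<in> {1..m}"
    using commutator_orbits_subset[OF \<Gamma> X] j(1) by blast
  ultimately show "\<exists>d. switch_equivalent {..<n} \<Gamma> c d \<and>
      (\<exists>i\<in>{1..m}. monochromatic {..<n} (a i) 2 d i)"
    by blast
qed

theorem theorem7:
  fixes m :: nat and \<Gamma> :: "(nat \<Rightarrow> nat) set" and a :: "nat \<Rightarrow> nat" and Os :: "nat set list"
  assumes "subgroup \<Gamma> (sym_group m)"
    and "\<And>i. i \<in> {1..m} \<Longrightarrow> a i \<ge> 2"
    and "distinct Os" and "set Os = commutator_orbits m \<Gamma>"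
  shows "switch_ramsey m \<Gamma> a \<le> ramsey_number (map (\<lambda>X. Min (a ` X)) Os)"
  unfolding switch_ramsey_def
  \<comment> \<open>The classical Ramsey number has its own partition property, hence the switching
    property, and so bounds the least number with the latter.\<close>
  by (rule Least_le) (rule switch_arrows_if_partn_lst[OF assms(1,4) partn_lst_ramsey_number])

end
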